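(* For any assignment rule $\mathcal X$, the posterior odds process satisfies, for every $t\in\mathbb N$ (almost surely), $$\Gamma_t=(\Gamma_{t-1}+\Pi_t)\,\frac{\Lambda_t}{1-\Pi_t},\qquad\text{where}\quad\Lambda_t=\frac{g_{X_t}(Y_t)}{f_{X_t}(Y_t)}.$$
   Context: Setup. Fix $2\le K<\infty$, $[K]=\{1,\dots,K\}$, $\mathbb N=\{1,2,\dots\}$. There is a latent process $L_t\in\{0,1\}$, $t\ge0$, with $L_t=0$ for $t<\Theta$ and $L_t=1$ for $t\ge\Theta$ ($\Theta$ is the change-point). At each $t\in\mathbb N$ a treatment $X_t\in[K]$ is selected and a response $Y_t$ in a Polish space $\mathbb Y$ is observed; $\mathcal F_t=\sigma(X_s,Y_s:1\le s\le t)$, $\mathcal F_0$ trivial. An assignment rule $\mathcal X=\{X_t\}$ has $X_1$ deterministic and $X_t$ a measurable function of $X_1,\dots,X_{t-1},Y_1,\dots,Y_{t-1}$. Response model: for each $x\in[K]$, $f_x,g_x$ are densities with respect to a $\sigma$-finite measure $\mu$ on $\mathbb Y$; given $X_t=x,L_t=i,\mathcal F_{t-1},L_0,\dots,L_{t-1}$, $Y_t$ has density $f_x$ if $i=0$, $g_x$ if $i=1$. Change-point model: $\pi_0\in[0,1)$ and functions $\pi_t:[K]^t\to[0,1)$ with $\mathsf P(L_0=1)=\pi_0$ and $\mathsf P(L_t=1\mid L_{t-1}=0,\mathcal F_{t-1},X_t)=\Pi_t:=\pi_t(X_1,\dots,X_t)$. Posterior odds: $\Gamma_t=\mathsf P(L_t=1\mid\mathcal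 F_t)/\mathsf P(L_t=0\mid\mathcal F_t)$ for $t\ge0$, with $\Gamma_0=\pi_0/(1-\pi_0)$ (values in $[0,\infty]$, with $a/0=\infty$ for $a>0$). *)

theory Defs
  imports "HOL-Probability.Probability" "HOL-Library.Extended_Nat"
begin

text \<open>
  Arms are the numbers \<open>{1..K}\<close>.  The processes \<open>X\<close> and \<open>Y\<close> are indexed by \<open>nat\<close>, but only
  their values at times \<open>t \<ge> 1\<close> are ever used.
\<close>

definition latent :: "('a \<Rightarrow> enat) \<Rightarrow> nat \<Rightarrow> 'a \<Rightarrow> nat" where
  "latent \<Theta> t \<omega> = (if enat t < \<Theta> \<omega> then 0 else 1)"

definition obs_filtration ::
    "'a measure \<Rightarrow> nat \<Rightarrow> (nat \<Rightarrow> 'a \<Rightarrow> nat) \<Rightarrow> (nat \<Rightarrow> 'a \<Rightarrow> 'y::topological_space) \<Rightarrow> nat \<Rightarrow> 'a measure" where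
  "obs_filtration M K X Y t = sigma (space M)
     (\<Union>s\<in>{1..t}. sets (vimage_algebra (space M) (X s) (count_space {1..K}))
                  \<union> sets (vimage_algebra (space M) (Y s) borel))"

text \<open>The \<sigma>-algebra generated by \<open>\<F>\<^sub>t\<^sub>-\<^sub>1\<close>, \<open>X\<^sub>t\<close> and \<open>L\<^sub>s\<close> for \<open>s \<in> I\<close>.\<close>

definition cond_algebra ::
    "'a measure \<Rightarrow> nat \<Rightarrow> ('a \<Rightarrow> enat) \<Rightarrow> (nat \<Rightarrow> 'a \<Rightarrow> nat) \<Rightarrow> (nat \<Rightarrow> 'a \<Rightarrow> 'y::topological_space)
      \<Rightarrow> nat \<Rightarrow> nat set \<Rightarrow> 'a measure" where
  "cond_algebra M K \<Theta> X Y t I = sigma (space M)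
     (sets (obs_filtration M K X Y (t - 1))
      \<union> sets (vimage_algebra (space M) (X t) (count_space {1..K}))
      \<union> (\<Union>s\<in>I. sets (vimage_algebra (space M) (latent \<Theta> s) (count_space {0, 1}))))"

definition cond_probability :: "'a measure \<Rightarrow> 'a measure \<Rightarrow> ('a \<Rightarrow> bool) \<Rightarrow> 'a \<Rightarrow> real" where
  "cond_probability M F P = real_cond_exp M F (indicator {\<omega> \<in> space M. P \<omega>})"

definition assignment_rule ::
    "'a measure \<Rightarrow> nat \<Rightarrow> (nat \<Rightarrow> 'a \<Rightarrow> nat) \<Rightarrow> (nat \<Rightarrow> 'a \<Rightarrow> 'y::topological_space) \<Rightarrow> bool" where
  "assignment_rule M K X Y \<longleftrightarrow>
     (\<exists>x\<in>{1..K}. \<forall>\<omega>\<in>space M. X 1 \<omega> = x) \<and>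
     (\<forall>t\<ge>2. \<exists>h \<in> (\<Pi>\<^sub>M s\<in>{1..<t}. count_space {1..K}) \<Otimes>\<^sub>M (\<Pi>\<^sub>M s\<in>{1..<t}. borel)
                       \<rightarrow>\<^sub>M count_space {1..K}.
        \<forall>\<omega>\<in>space M. X t \<omega> = h (\<lambda>s\<in>{1..<t}. X s \<omega>, \<lambda>s\<in>{1..<t}. Y s \<omega>))"

definition density_family :: "'y measure \<Rightarrow> nat \<Rightarrow> (nat \<Rightarrow> 'y \<Rightarrow> real) \<Rightarrow> bool" where
  "density_family \<mu> K f \<longleftrightarrow>
     (\<forall>x\<in>{1..K}. f x \<in> borel_measurable \<mu> \<and> (\<forall>y\<in>space \<mu>. 0 \<le> f x y)
                  \<and> (\<integral>\<^sup>+ y. ennreal (f x y) \<partial>\<mu>) = 1)"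

text \<open>
  The conditional law of \<open>Y\<^sub>t\<close> given \<open>X\<^sub>t, L\<^sub>t, \<F>\<^sub>t\<^sub>-\<^sub>1, L\<^sub>0, \<dots>, L\<^sub>t\<^sub>-\<^sub>1\<close> is
  \<open>f\<^sub>x d\<mu>\<close> or \<open>g\<^sub>x d\<mu>\<close> with \<open>x = X\<^sub>t\<close>, according to the value of \<open>L\<^sub>t\<close>.
\<close>

definition response_model ::
    "'a measure \<Rightarrow> nat \<Rightarrow> 'y measure \<Rightarrow> (nat \<Rightarrow> 'y \<Rightarrow> real) \<Rightarrow> (nat \<Rightarrow> 'y \<Rightarrow> real) \<Rightarrow> ('a \<Rightarrow> enat)
      \<Rightarrow> (nat \<Rightarrow> 'a \<Rightarrow> nat) \<Rightarrow> (nat \<Rightarrow> 'a \<Rightarrow> 'y::topological_space) \<Rightarrow> bool" where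
  "response_model M K \<mu> f g \<Theta> X Y \<longleftrightarrow>
     (\<forall>t\<ge>1. \<forall>B\<in>sets borel. AE \<omega> in M.
        cond_probability M (cond_algebra M K \<Theta> X Y t {0..t}) (\<lambda>\<omega>. Y t \<omega> \<in> B) \<omega> =
        (if latent \<Theta> t \<omega> = 0 then measure (density \<mu> (f (X t \<omega>))) B
         else measure (density \<mu> (g (X t \<omega>))) B))"

text \<open>\<open>\<pi> t\<close> is a function on \<open>[K]\<^sup>t\<close>, represented as \<open>{1..t} \<rightarrow>\<^sub>E {1..K}\<close>.\<close>

definition trans_prob ::
    "(nat \<Rightarrow> (nat \<Rightarrow> nat) \<Rightarrow> real) \<Rightarrow> (nat \<Rightarrow> 'a \<Rightarrow> nat) \<Rightarrow> nat \<Rightarrow> 'a \<Rightarrow> real" where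
  "trans_prob \<pi> X t \<omega> = \<pi> t (\<lambda>s\<in>{1..t}. X s \<omega>)"

text \<open>
  Conditioning on the event \<open>L\<^sub>t\<^sub>-\<^sub>1 = 0\<close> together with \<open>\<F>\<^sub>t\<^sub>-\<^sub>1\<close> and \<open>X\<^sub>t\<close> is rendered as the
  conditional probability given \<open>L\<^sub>t\<^sub>-\<^sub>1\<close>, \<open>\<F>\<^sub>t\<^sub>-\<^sub>1\<close> and \<open>X\<^sub>t\<close>, evaluated where \<open>L\<^sub>t\<^sub>-\<^sub>1 = 0\<close>.
\<close>

definition change_point_model ::
    "'a measure \<Rightarrow> nat \<Rightarrow> real \<Rightarrow> (nat \<Rightarrow> (nat \<Rightarrow> nat) \<Rightarrow> real) \<Rightarrow> ('a \<Rightarrow> enat)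
      \<Rightarrow> (nat \<Rightarrow> 'a \<Rightarrow> nat) \<Rightarrow> (nat \<Rightarrow> 'a \<Rightarrow> 'y::topological_space) \<Rightarrow> bool" where
  "change_point_model M K \<pi>0 \<pi> \<Theta> X Y \<longleftrightarrow>
     measure M {\<omega> \<in> space M. latent \<Theta> 0 \<omega> = 1} = \<pi>0 \<and>
     (\<forall>t\<ge>1. AE \<omega> in M. latent \<Theta> (t - 1) \<omega> = 0 \<longrightarrow>
        cond_probability M (cond_algebra M K \<Theta> X Y t {t - 1}) (\<lambda>\<omega>. latent \<Theta> t \<omega> = 1) \<omega> =
        trans_prob \<pi> X t \<omega>)"

text \<open>
  Ratios are taken in \<open>[0,\<infinity>]\<close>, where \<open>a / 0 = \<infinity>\<close> for \<open>a > 0\<close>; Isabelle's remaining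
  conventions \<open>0 / 0 = 0\<close> and \<open>0 * \<infinity> = 0\<close> only matter on null sets in the recursion.
\<close>

definition posterior_odds ::
    "'a measure \<Rightarrow> nat \<Rightarrow> ('a \<Rightarrow> enat) \<Rightarrow> (nat \<Rightarrow> 'a \<Rightarrow> nat) \<Rightarrow> (nat \<Rightarrow> 'a \<Rightarrow> 'y::topological_space)
      \<Rightarrow> nat \<Rightarrow> 'a \<Rightarrow> ennreal" where
  "posterior_odds M K \<Theta> X Y t \<omega> =
     ennreal (cond_probability M (obs_filtration M K X Y t) (\<lambda>\<omega>. latent \<Theta> t \<omega> = 1) \<omega>) /
     ennreal (cond_probability M (obs_filtration M K X Y t) (\<lambda>\<omega>. latent \<Theta> t \<omega> = 0) \<omega>)"

text \<open>Since \<open>\<F>\<^sub>0\<close> is trivial, the initial value \<open>\<Gamma>\<^sub>0 = \<pi>\<^sub>0 / (1 - \<pi>\<^sub>0)\<close> is a consequence.\<close>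

lemma cond_probability_trivial:
  assumes "prob_space M" and P: "{\<omega> \<in> space M. P \<omega>} \<in> sets M"
  shows "AE \<omega> in M. cond_probability M (obs_filtration M K X Y 0) P \<omega> = measure M {\<omega> \<in> space M. P \<omega>}"
proof -
  interpret prob_space M by fact
  let ?F = "obs_filtration M K X Y 0" and ?A = "{\<omega> \<in> space M. P \<omega>}"
  have sp: "space ?F = space M" and st: "sets ?F = {{}, space M}"
    by (auto simp: obs_filtration_def sigma_sets_empty_eq)
  have sub: "subalgebra M ?F" by (auto simp: subalgebra_def sp st)
  interpret S: finite_measure_subalgebra M ?F by unfold_locales (rule sub)
  have int: "integrable M (indicator ?A :: _ \<Rightarrow> real)"
    using P by (intro integrable_real_indicator) (auto simp: emeasure_eq_measure)
  have "AE \<omega> in M. real_cond_exp M ?F (indicator ?A) \<omega> = measure M ?A"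
  proof (rule S.real_cond_exp_charact)
    fix B assume "B \<in> sets ?F"
    then consider "B = {}" | "B = space M" using st by auto
    then show "(\<integral> x \<in> B. indicator ?A x \<partial>M) = (\<integral> x \<in> B. measure M ?A \<partial>M)"
    proof cases
      case 2
      then show ?thesis using P int
        by (simp add: set_integral_space prob_space)
    qed (simp add: set_lebesgue_integral_def)
  qed (use int in auto)
  then show ?thesis by (simp add: cond_probability_def)
qed

lemma posterior_odds_0:
  assumes "prob_space M" and "\<Theta> \<in> M \<rightarrow>\<^sub>M count_space UNIV" and "\<pi>0 < 1"
    and "change_point_model M K \<pi>0 \<pi> \<Theta> X Y"
  shows "AE \<omega> in M. posterior_odds M K \<Theta> X Y 0 \<omega> = ennreal \<pi>0 / ennreal (1 - \<pi>0)"
proof -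
  interpret prob_space M by fact
  note [measurable] = assms(2)
  have *: "{\<omega> \<in> space M. latent \<Theta> 0 \<omega> = i} \<in> sets M" for i
    unfolding latent_def by measurable
  have 1: "measure M {\<omega> \<in> space M. latent \<Theta> 0 \<omega> = 1} = \<pi>0"
    using assms(4) by (simp add: change_point_model_def)
  have "{\<omega> \<in> space M. latent \<Theta> 0 \<omega> = 0} = space M - {\<omega> \<in> space M. latent \<Theta> 0 \<omega> = 1}"
    by (auto simp: latent_def split: if_splits)
  then have 0: "measure M {\<omega> \<in> space M. latent \<Theta> 0 \<omega> = 0} = 1 - \<pi>0"
    using prob_compl[OF *] 1 by simp
  show ?thesis
    using cond_probability_trivial[OF assms(1) *[of 1], where K=K and X=X and Y=Y]
      cond_probability_trivial[OF assms(1) *[of 0], where K=K and X=X and Y=Y]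
    unfolding posterior_odds_def 0 1 by eventually_elim simp
qed

definition likelihood_ratio ::
    "(nat \<Rightarrow> 'y \<Rightarrow> real) \<Rightarrow> (nat \<Rightarrow> 'y \<Rightarrow> real) \<Rightarrow> (nat \<Rightarrow> 'a \<Rightarrow> nat) \<Rightarrow> (nat \<Rightarrow> 'a \<Rightarrow> 'y) \<Rightarrow> nat \<Rightarrow> 'a \<Rightarrow> ennreal" where
  "likelihood_ratio f g X Y t \<omega> = ennreal (g (X t \<omega>) (Y t \<omega>)) / ennreal (f (X t \<omega>) (Y t \<omega>))"

end

theory Submission
  imports Defs
begin

text \<open>
  Since \<open>X\<^sub>t\<close> is predictable, \<open>\<F>\<^sub>t\<close> is generated by \<open>\<F>\<^sub>t\<^sub>-\<^sub>1\<close> and \<open>Y\<^sub>t\<close>.  Write \<open>p\<close> for the conditional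
  probability of \<open>L\<^sub>t\<^sub>-\<^sub>1 = 0\<close> given \<open>\<F>\<^sub>t\<^sub>-\<^sub>1\<close>; the change-point model turns it into \<open>r = p (1 - \<Pi>\<^sub>t)\<close> for
  \<open>L\<^sub>t = 0\<close>.  By the response model, the law of \<open>(\<omega>, Y\<^sub>t \<omega>)\<close> on the events \<open>L\<^sub>t = 0\<close> and \<open>L\<^sub>t = 1\<close> has
  densities \<open>r f\<close> and \<open>(1 - r) g\<close> with respect to the product of \<open>P\<close> restricted to \<open>\<F>\<^sub>t\<^sub>-\<^sub>1\<close> and \<open>\<mu>\<close>.
  Bayes' formula gives \<open>\<Gamma>\<^sub>t = (1 - r) g / (r f)\<close>, and \<open>1 - r = (1 - p) + p \<Pi>\<^sub>t\<close>.  The degenerate cases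
  \<open>p = 0\<close> and \<open>f = 0\<close> are harmless because \<open>r f + (1 - r) g > 0\<close> almost surely.
\<close>

lemma distr_pair_eq_density:
  fixes Y :: "'a \<Rightarrow> 'y" and a :: "'a \<times> 'y \<Rightarrow> ennreal"
  assumes "finite_measure M" and sub: "subalgebra M F" and "sigma_finite_measure \<nu>"
    and Y [measurable]: "Y \<in> M \<rightarrow>\<^sub>M \<nu>" and E [measurable]: "E \<in> sets M"
    and a [measurable]: "a \<in> borel_measurable (F \<Otimes>\<^sub>M \<nu>)"
    and eq: "\<And>A B. A \<in> sets F \<Longrightarrow> B \<in> sets \<nu> \<Longrightarrow>
      emeasure M {\<omega> \<in> A. Y \<omega> \<in> B \<and> \<omega> \<in> E} = (\<integral>\<^sup>+\<omega>\<in>A. (\<integral>\<^sup>+y\<in>B. a (\<omega>, y) \<partial>\<nu>) \<partial>M)"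
  shows "distr (density M (indicator E)) (F \<Otimes>\<^sub>M \<nu>) (\<lambda>\<omega>. (\<omega>, Y \<omega>))
    = density (restr_to_subalg M F \<Otimes>\<^sub>M \<nu>) a"
    (is "?L = ?R")
proof -
  interpret M: finite_measure M by fact
  interpret \<nu>: sigma_finite_measure \<nu> by fact
  have [measurable_cong]: "sets (restr_to_subalg M F) = sets F"
    using sub by (rule sets_restr_to_subalg)
  have [measurable]: "a \<in> borel_measurable (restr_to_subalg M F \<Otimes>\<^sub>M \<nu>)"
    using a by (simp cong: measurable_cong_sets sets_pair_measure_cong)
  have spF: "space F = space M" and FM: "sets F \<subseteq> sets M"
    using sub by (auto simp: subalgebra_def)
  have idF [measurable]: "(\<lambda>\<omega>. \<omega>) \<in> M \<rightarrow>\<^sub>M F"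
    by (rule measurable_from_subalg[OF sub]) simp
  have L: "emeasure ?L (A \<times> B) = emeasure M {\<omega> \<in> A. Y \<omega> \<in> B \<and> \<omega> \<in> E}"
    if "A \<in> sets F" "B \<in> sets \<nu>" for A B
  proof -
    have [measurable]: "A \<in> sets M" "A \<in> sets F" "B \<in> sets \<nu>" using that FM by auto
    have *: "(\<lambda>\<omega>. (\<omega>, Y \<omega>)) -` (A \<times> B) \<inter> space M = {\<omega> \<in> A. Y \<omega> \<in> B}"
      using sets.sets_into_space[OF \<open>A \<in> sets M\<close>] by auto
    have [measurable]: "{\<omega> \<in> A. Y \<omega> \<in> B} \<in> sets M" unfolding *[symmetric] by measurable
    have "emeasure ?L (A \<times> B) = emeasure (density M (indicator E)) {\<omega> \<in> A. Y \<omega> \<in> B}"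
      by (subst emeasure_distr) (auto simp: *)
    also have "\<dots> = emeasure M (E \<inter> {\<omega> \<in> A. Y \<omega> \<in> B})"
      by (subst emeasure_density)
         (auto simp: indicator_inter_arith[symmetric] simp del: indicator_inter_arith intro: nn_integral_indicator)
    also have "E \<inter> {\<omega> \<in> A. Y \<omega> \<in> B} = {\<omega> \<in> A. Y \<omega> \<in> B \<and> \<omega> \<in> E}" by auto
    finally show ?thesis .
  qed
  have R: "emeasure ?R (A \<times> B) = (\<integral>\<^sup>+\<omega>\<in>A. (\<integral>\<^sup>+y\<in>B. a (\<omega>, y) \<partial>\<nu>) \<partial>M)"
    if [measurable]: "A \<in> sets F" "B \<in> sets \<nu>" for A B
  proof -
    have "emeasure ?R (A \<times> B) = (\<integral>\<^sup>+z. a z * indicator (A \<times> B) z \<partial>(restr_to_subalg M F \<Otimes>\<^sub>M \<nu>))"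
      by (subst emeasure_density) auto
    also have "\<dots> = (\<integral>\<^sup>+\<omega>. \<integral>\<^sup>+y. a (\<omega>, y) * indicator (A \<times> B) (\<omega>, y) \<partial>\<nu> \<partial>restr_to_subalg M F)"
      by (subst \<nu>.nn_integral_fst[symmetric]) auto
    also have "\<dots> = (\<integral>\<^sup>+\<omega>. \<integral>\<^sup>+y. a (\<omega>, y) * indicator B y * indicator A \<omega> \<partial>\<nu> \<partial>restr_to_subalg M F)"
      by (simp add: indicator_times mult_ac)
    also have "\<dots> = (\<integral>\<^sup>+\<omega>\<in>A. (\<integral>\<^sup>+y\<in>B. a (\<omega>, y) \<partial>\<nu>) \<partial>restr_to_subalg M F)"
    proof (rule nn_integral_cong)
      fix \<omega> assume "\<omega> \<in> space (restr_to_subalg M F)"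
      then have [simp]: "\<omega> \<in> space F" by (simp add: space_restr_to_subalg spF)
      show "(\<integral>\<^sup>+y. a (\<omega>, y) * indicator B y * indicator A \<omega> \<partial>\<nu>)
          = (\<integral>\<^sup>+y\<in>B. a (\<omega>, y) \<partial>\<nu>) * indicator A \<omega>"
        by (rule nn_integral_multc) measurable
    qed
    also have "\<dots> = (\<integral>\<^sup>+\<omega>\<in>A. (\<integral>\<^sup>+y\<in>B. a (\<omega>, y) \<partial>\<nu>) \<partial>M)"
      by (rule nn_integral_subalgebra2[OF sub]) measurable
    finally show ?thesis .
  qed
  show ?thesis
  proof (rule measure_eqI_generator_eq[OF Int_stable_pair_measure_generator pair_measure_closed])
    show "emeasure ?L C = emeasure ?R C" if "C \<in> {A \<times> B |A B. A \<in> sets F \<and> B \<in> sets \<nu>}" for C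
      using that L R eq by auto
    show "sets ?L = sigma_sets (space F \<times> space \<nu>) {A \<times> B |A B. A \<in> sets F \<and> B \<in> sets \<nu>}"
      by (simp add: sets_pair_measure)
    show "sets ?R = sigma_sets (space F \<times> space \<nu>) {A \<times> B |A B. A \<in> sets F \<and> B \<in> sets \<nu>}"
      by (simp add: sets_pair_measure space_restr_to_subalg sets_restr_to_subalg[OF sub] spF)
    show "range (\<lambda>_::nat. space F \<times> space \<nu>) \<subseteq> {A \<times> B |A B. A \<in> sets F \<and> B \<in> sets \<nu>}"
      by auto
    show "emeasure ?L (space F \<times> space \<nu>) \<noteq> \<infinity>"
      by (subst L) (auto simp: M.emeasure_eq_measure)
  qed auto
qed

lemma real_cond_exp_bayes:
  fixes Y :: "'a \<Rightarrow> 'y" and a b :: "'a \<times> 'y \<Rightarrow> real"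
  assumes "finite_measure M" and subF: "subalgebra M F" and subG: "subalgebra M G"
    and "sigma_finite_measure \<nu>"
    and G: "sets G = sets (vimage_algebra (space M) (\<lambda>\<omega>. (\<omega>, Y \<omega>)) (F \<Otimes>\<^sub>M \<nu>))"
    and Y [measurable]: "Y \<in> M \<rightarrow>\<^sub>M \<nu>" and E [measurable]: "E \<in> sets M"
    and a [measurable]: "a \<in> borel_measurable (F \<Otimes>\<^sub>M \<nu>)" and a0: "\<And>z. 0 \<le> a z"
    and b [measurable]: "b \<in> borel_measurable (F \<Otimes>\<^sub>M \<nu>)" and b0: "\<And>z. 0 \<le> b z"
    and eq_a: "\<And>A B. A \<in> sets F \<Longrightarrow> B \<in> sets \<nu> \<Longrightarrow>
      emeasure M {\<omega> \<in> A. Y \<omega> \<in> B \<and> \<omega> \<in> E} = (\<integral>\<^sup>+\<omega>\<in>A. (\<integral>\<^sup>+y\<in>B. a (\<omega>, y) \<partial>\<nu>) \<partial>M)"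
    and eq_b: "\<And>A B. A \<in> sets F \<Longrightarrow> B \<in> sets \<nu> \<Longrightarrow>
      emeasure M {\<omega> \<in> A. Y \<omega> \<in> B \<and> \<omega> \<in> space M - E} = (\<integral>\<^sup>+\<omega>\<in>A. (\<integral>\<^sup>+y\<in>B. b (\<omega>, y) \<partial>\<nu>) \<partial>M)"
  shows "AE \<omega> in M. 0 < a (\<omega>, Y \<omega>) + b (\<omega>, Y \<omega>)"
    and "AE \<omega> in M. real_cond_exp M G (indicator E) \<omega> = a (\<omega>, Y \<omega>) / (a (\<omega>, Y \<omega>) + b (\<omega>, Y \<omega>))"
proof -
  interpret M: finite_measure M by fact
  interpret G: finite_measure_subalgebra M G by unfold_locales (rule subG)
  let ?P = "restr_to_subalg M F \<Otimes>\<^sub>M \<nu>"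
  have [measurable_cong]: "sets (restr_to_subalg M F) = sets F"
    using subF by (rule sets_restr_to_subalg)
  have spF: "space F = space M" and FM: "sets F \<subseteq> sets M"
    using subF by (auto simp: subalgebra_def)
  have idF [measurable]: "(\<lambda>\<omega>. \<omega>) \<in> M \<rightarrow>\<^sub>M F"
    by (rule measurable_from_subalg[OF subF]) simp
  have joint: "(\<integral>\<^sup>+\<omega>. h (\<omega>, Y \<omega>) * indicator C \<omega> \<partial>M) = (\<integral>\<^sup>+z. ennreal (c z) * h z \<partial>?P)"
    if C [measurable]: "C \<in> sets M" and c [measurable]: "c \<in> borel_measurable (F \<Otimes>\<^sub>M \<nu>)"
      and h [measurable]: "h \<in> borel_measurable (F \<Otimes>\<^sub>M \<nu>)"
      and eq: "\<And>A B. A \<in> sets F \<Longrightarrow> B \<in> sets \<nu> \<Longrightarrow>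
      emeasure M {\<omega> \<in> A. Y \<omega> \<in> B \<and> \<omega> \<in> C} = (\<integral>\<^sup>+\<omega>\<in>A. (\<integral>\<^sup>+y\<in>B. ennreal (c (\<omega>, y)) \<partial>\<nu>) \<partial>M)"
    for C c and h :: "'a \<times> 'y \<Rightarrow> ennreal"
  proof -
    have "(\<integral>\<^sup>+\<omega>. h (\<omega>, Y \<omega>) * indicator C \<omega> \<partial>M) = (\<integral>\<^sup>+\<omega>. h (\<omega>, Y \<omega>) \<partial>density M (indicator C))"
      by (subst nn_integral_density) (auto simp: mult.commute)
    also have "\<dots> = (\<integral>\<^sup>+z. h z \<partial>distr (density M (indicator C)) (F \<Otimes>\<^sub>M \<nu>) (\<lambda>\<omega>. (\<omega>, Y \<omega>)))"
      by (subst nn_integral_distr) auto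
    also have "\<dots> = (\<integral>\<^sup>+z. h z \<partial>density ?P c)"
      by (subst distr_pair_eq_density[OF assms(1) subF assms(4) Y C _ eq]) auto
    also have "\<dots> = (\<integral>\<^sup>+z. ennreal (c z) * h z \<partial>?P)"
      by (rule nn_integral_density) measurable
    finally show ?thesis .
  qed
  have total: "(\<integral>\<^sup>+\<omega>. h (\<omega>, Y \<omega>) \<partial>M) = (\<integral>\<^sup>+z. ennreal (a z + b z) * h z \<partial>?P)"
    if h [measurable]: "h \<in> borel_measurable (F \<Otimes>\<^sub>M \<nu>)" for h
  proof -
    have "(\<integral>\<^sup>+\<omega>. h (\<omega>, Y \<omega>) \<partial>M) =
      (\<integral>\<^sup>+\<omega>. h (\<omega>, Y \<omega>) * indicator E \<omega> + h (\<omega>, Y \<omega>) * indicator (space M - E) \<omega> \<partial>M)"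
      by (rule nn_integral_cong) (auto simp: indicator_def)
    also have "\<dots> = (\<integral>\<^sup>+\<omega>. h (\<omega>, Y \<omega>) * indicator E \<omega> \<partial>M) + (\<integral>\<^sup>+\<omega>. h (\<omega>, Y \<omega>) * indicator (space M - E) \<omega> \<partial>M)"
      by (rule nn_integral_add) auto
    also have "\<dots> = (\<integral>\<^sup>+z. ennreal (a z) * h z \<partial>?P) + (\<integral>\<^sup>+z. ennreal (b z) * h z \<partial>?P)"
      by (subst (1 2) joint[OF _ _ h]) (use eq_a eq_b in auto)
    also have "\<dots> = (\<integral>\<^sup>+z. ennreal (a z) * h z + ennreal (b z) * h z \<partial>?P)"
      by (rule nn_integral_add[symmetric]) auto
    also have "\<dots> = (\<integral>\<^sup>+z. ennreal (a z + b z) * h z \<partial>?P)"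
      by (simp add: a0 b0 distrib_right)
    finally show ?thesis .
  qed
  show "AE \<omega> in M. 0 < a (\<omega>, Y \<omega>) + b (\<omega>, Y \<omega>)"
  proof -
    let ?h = "\<lambda>z. if a z + b z = 0 then 1 else 0 :: ennreal"
    have "(\<integral>\<^sup>+\<omega>. ?h (\<omega>, Y \<omega>) \<partial>M) = (\<integral>\<^sup>+z. ennreal (a z + b z) * ?h z \<partial>?P)"
      by (rule total) measurable
    also have "\<dots> = (\<integral>\<^sup>+z. 0 \<partial>?P)"
      by (rule nn_integral_cong) auto
    finally have "(\<integral>\<^sup>+\<omega>. ?h (\<omega>, Y \<omega>) \<partial>M) = 0"
      by simp
    then have "AE \<omega> in M. ?h (\<omega>, Y \<omega>) = 0"
      by (subst (asm) nn_integral_0_iff_AE) (auto simp: if_distrib cong: if_cong)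
    then show ?thesis
    proof (rule eventually_mono)
      fix \<omega> assume "?h (\<omega>, Y \<omega>) = 0"
      then show "0 < a (\<omega>, Y \<omega>) + b (\<omega>, Y \<omega>)"
        using add_nonneg_nonneg[OF a0 b0, of "(\<omega>, Y \<omega>)" "(\<omega>, Y \<omega>)"] by (simp add: less_le split: if_splits)
    qed
  qed
  define N where "N = (\<lambda>z. a z / (a z + b z))"
  have N [measurable]: "N \<in> borel_measurable (F \<Otimes>\<^sub>M \<nu>)" unfolding N_def by measurable
  have N0: "0 \<le> N z" "N z \<le> 1" and ND: "(a z + b z) * N z = a z" for z
    using a0[of z] b0[of z] by (auto simp: N_def divide_le_eq_1)
  have YM: "(\<lambda>\<omega>. (\<omega>, Y \<omega>)) \<in> M \<rightarrow>\<^sub>M F \<Otimes>\<^sub>M \<nu>" by measurable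
  then have Ysp: "(\<lambda>\<omega>. (\<omega>, Y \<omega>)) \<in> space M \<rightarrow> space (F \<Otimes>\<^sub>M \<nu>)"
    by (auto simp: measurable_def)
  have NY: "(\<lambda>\<omega>. N (\<omega>, Y \<omega>)) \<in> borel_measurable G"
    using measurable_compose[OF measurable_vimage_algebra1[OF Ysp] N]
    by (simp add: measurable_cong_sets[OF G refl])
  have NYM [measurable]: "(\<lambda>\<omega>. N (\<omega>, Y \<omega>)) \<in> borel_measurable M"
    by measurable
  have int: "integrable M (\<lambda>\<omega>. N (\<omega>, Y \<omega>))"
    by (rule M.integrable_const_bound[where B=1]) (use N0 in auto)
  have "AE \<omega> in M. real_cond_exp M G (indicator E) \<omega> = N (\<omega>, Y \<omega>)"
  proof (rule G.real_cond_exp_charact)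
    fix C assume "C \<in> sets G"
    then have CM [measurable]: "C \<in> sets M" using subG by (auto simp: subalgebra_def)
    obtain S where S [measurable]: "S \<in> sets (F \<Otimes>\<^sub>M \<nu>)" and C: "C = (\<lambda>\<omega>. (\<omega>, Y \<omega>)) -` S \<inter> space M"
      using \<open>C \<in> sets G\<close> unfolding G sets_vimage_algebra2[OF Ysp] by auto
    have "(\<integral>\<omega>\<in>C. indicator E \<omega> \<partial>M) = measure M (C \<inter> E)"
      unfolding set_lebesgue_integral_def
      by (simp add: indicator_inter_arith[symmetric] del: indicator_inter_arith)
    also have "\<dots> = enn2real (\<integral>\<^sup>+\<omega>. indicator S (\<omega>, Y \<omega>) * indicator E \<omega> \<partial>M)"
    proof -
      have "emeasure M (C \<inter> E) = (\<integral>\<^sup>+\<omega>. indicator (C \<inter> E) \<omega> \<partial>M)" by simp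
      also have "\<dots> = (\<integral>\<^sup>+\<omega>. indicator S (\<omega>, Y \<omega>) * indicator E \<omega> \<partial>M)"
        by (rule nn_integral_cong) (auto simp: C indicator_def)
      finally show ?thesis by (simp add: measure_def)
    qed
    also have "(\<integral>\<^sup>+\<omega>. indicator S (\<omega>, Y \<omega>) * indicator E \<omega> \<partial>M) = (\<integral>\<^sup>+z. ennreal (a z) * indicator S z \<partial>?P)"
      by (rule joint) (use eq_a in auto)
    also have "\<dots> = (\<integral>\<^sup>+z. ennreal (a z + b z) * (ennreal (N z) * indicator S z) \<partial>?P)"
      by (rule nn_integral_cong) (use a0 b0 in \<open>simp add: mult.assoc[symmetric] ennreal_mult'[symmetric] N0 ND del: ennreal_plus\<close>)
    also have "\<dots> = (\<integral>\<^sup>+\<omega>. ennreal (N (\<omega>, Y \<omega>)) * indicator S (\<omega>, Y \<omega>) \<partial>M)"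
      by (rule total[symmetric]) measurable
    also have "\<dots> = (\<integral>\<^sup>+\<omega>. ennreal (indicator C \<omega> * N (\<omega>, Y \<omega>)) \<partial>M)"
      by (rule nn_integral_cong) (auto simp: C indicator_def)
    also have "enn2real \<dots> = (\<integral>\<omega>\<in>C. N (\<omega>, Y \<omega>) \<partial>M)"
      unfolding set_lebesgue_integral_def by (subst integral_eq_nn_integral) (auto simp: N0)
    finally show "(\<integral>\<omega>\<in>C. indicator E \<omega> \<partial>M) = (\<integral>\<omega>\<in>C. N (\<omega>, Y \<omega>) \<partial>M)" .
  qed (use int NY in \<open>auto simp: M.emeasure_eq_measure\<close>)
  then show "AE \<omega> in M. real_cond_exp M G (indicator E) \<omega> = a (\<omega>, Y \<omega>) / (a (\<omega>, Y \<omega>) + b (\<omega>, Y \<omega>))"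
    by (simp add: N_def)
qed

lemma measure_Int_cond_exp:
  assumes "finite_measure M" and FG: "subalgebra G F" and GM: "subalgebra M G"
    and S [measurable]: "S \<in> sets M" and E: "E \<in> sets G" and A: "A \<in> sets F"
    and k [measurable]: "k \<in> borel_measurable F" and k_bound: "\<And>\<omega>. \<omega> \<in> space M \<Longrightarrow> \<bar>k \<omega>\<bar> \<le> 1"
    and k_eq: "AE \<omega> in M. \<omega> \<in> E \<longrightarrow> real_cond_exp M G (indicator S) \<omega> = k \<omega>"
  shows "measure M (A \<inter> S \<inter> E) = (\<integral>\<omega>\<in>A. k \<omega> * real_cond_exp M F (indicator E) \<omega> \<partial>M)"
proof -
  interpret M: finite_measure M by fact
  have FM: "subalgebra M F" using FG GM by (auto simp: subalgebra_def)
  interpret F: finite_measure_subalgebra M F by unfold_locales (rule FM)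
  interpret G: finite_measure_subalgebra M G by unfold_locales (rule GM)
  have AG: "A \<in> sets G" using A FG by (auto simp: subalgebra_def)
  have [measurable]: "A \<in> sets M" "E \<in> sets M" "A \<in> sets F" "A \<inter> E \<in> sets M"
    using A AG E GM by (auto simp: subalgebra_def)
  have [measurable]: "k \<in> borel_measurable M" by (rule measurable_from_subalg[OF FM k])
  have int: "integrable M (indicator C :: _ \<Rightarrow> real)" if "C \<in> sets M" for C
    using that by (intro integrable_real_indicator) (auto simp: M.emeasure_eq_measure)
  have "measure M (A \<inter> S \<inter> E) = (\<integral>\<omega>\<in>A \<inter> E. indicator S \<omega> \<partial>M)"
    unfolding set_lebesgue_integral_def
    by (simp add: indicator_inter_arith[symmetric] Int_ac del: indicator_inter_arith)
  also have "\<dots> = (\<integral>\<omega>\<in>A \<inter> E. real_cond_exp M G (indicator S) \<omega> \<partial>M)"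
    by (rule G.real_cond_exp_intA) (use int AG E in auto)
  also have "\<dots> = (\<integral>\<omega>\<in>A \<inter> E. k \<omega> \<partial>M)"
    unfolding set_lebesgue_integral_def
    by (rule integral_cong_AE) (use k_eq in \<open>auto simp: indicator_def elim!: eventually_mono\<close>)
  also have "\<dots> = (\<integral>\<omega>. (indicator A \<omega> * k \<omega>) * indicator E \<omega> \<partial>M)"
    unfolding set_lebesgue_integral_def
    by (rule Bochner_Integration.integral_cong) (auto simp: indicator_def)
  also have "\<dots> = (\<integral>\<omega>. (indicator A \<omega> * k \<omega>) * real_cond_exp M F (indicator E) \<omega> \<partial>M)"
  proof (rule F.real_cond_exp_intg(2)[symmetric])
    show "integrable M (\<lambda>\<omega>. indicator A \<omega> * k \<omega> * indicator E \<omega>)"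
      by (rule M.integrable_const_bound[where B=1]) (use k_bound in \<open>auto simp: indicator_def\<close>)
  qed auto
  finally show ?thesis
    by (simp add: set_lebesgue_integral_def mult.assoc)
qed

lemma real_cond_exp_indicator_nonneg_compl:
  assumes "finite_measure M" and FM: "subalgebra M F" and E [measurable]: "E \<in> sets M"
  shows "AE \<omega> in M. 0 \<le> real_cond_exp M F (indicator E) \<omega>"
    and "AE \<omega> in M. real_cond_exp M F (indicator (space M - E)) \<omega> = 1 - real_cond_exp M F (indicator E) \<omega>"
proof -
  interpret M: finite_measure M by fact
  interpret F: finite_measure_subalgebra M F by unfold_locales (rule FM)
  have int: "integrable M (indicator C :: _ \<Rightarrow> real)" if "C \<in> sets M" for C
    using that by (intro integrable_real_indicator) (auto simp: M.emeasure_eq_measure)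
  show "AE \<omega> in M. 0 \<le> real_cond_exp M F (indicator E) \<omega>"
    by (rule F.real_cond_exp_pos) auto
  have "AE \<omega> in M. real_cond_exp M F (indicator (space M - E)) \<omega>
      = real_cond_exp M F (\<lambda>\<omega>. 1 - indicator E \<omega>) \<omega>"
    by (rule F.real_cond_exp_cong) (auto simp: indicator_def)
  moreover have "AE \<omega> in M. real_cond_exp M F (\<lambda>\<omega>. 1 - indicator E \<omega>) \<omega>
      = real_cond_exp M F (\<lambda>_. 1) \<omega> - real_cond_exp M F (indicator E) \<omega>"
    by (rule F.real_cond_exp_diff) (auto simp: int)
  moreover have "AE \<omega> in M. real_cond_exp M F (\<lambda>_. 1) \<omega> = 1"
    by (rule F.real_cond_exp_F_meas) auto
  ultimately show "AE \<omega> in M. real_cond_exp M F (indicator (space M - E)) \<omega> = 1 - real_cond_exp M F (indicator E) \<omega>"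
    by eventually_elim simp
qed

lemma space_obs_filtration [simp]: "space (obs_filtration M K X Y t) = space M"
  by (simp add: obs_filtration_def space_measure_of_conv)

lemma sets_obs_filtration_subset:
  assumes "space N = space M"
    and "\<And>s. s \<in> {1..t} \<Longrightarrow> X s \<in> N \<rightarrow>\<^sub>M count_space {1..K}"
    and "\<And>s. s \<in> {1..t} \<Longrightarrow> Y s \<in> N \<rightarrow>\<^sub>M borel"
  shows "sets (obs_filtration M K X Y t) \<subseteq> sets N"
proof -
  have sub: "(\<Union>s\<in>{1..t}. sets (vimage_algebra (space M) (X s) (count_space {1..K}))
                  \<union> sets (vimage_algebra (space M) (Y s) borel)) \<subseteq> sets N"
  proof (rule UN_least, rule Un_least)
    fix s assume s: "s \<in> {1..t}"
    show "sets (vimage_algebra (space M) (X s) (count_space {1..K})) \<subseteq> sets N"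
      by (rule sets_image_in_sets[OF assms(1) assms(2)[OF s]])
    show "sets (vimage_algebra (space M) (Y s) borel) \<subseteq> sets N"
      by (rule sets_image_in_sets[OF assms(1) assms(3)[OF s]])
  qed
  have "sets (obs_filtration M K X Y t) = sigma_sets (space M) (\<Union>s\<in>{1..t}. sets (vimage_algebra (space M) (X s) (count_space {1..K}))
                  \<union> sets (vimage_algebra (space M) (Y s) borel))"
    unfolding obs_filtration_def
    by (rule sets_measure_of) (use sets.space_closed[of N] sub assms(1) in simp)
  also have "\<dots> \<subseteq> sets N"
    using sets.sigma_sets_subset[OF sub] assms(1) by simp
  finally show ?thesis .
qed

lemma measurable_obs_filtration:
  assumes "s \<in> {1..t}"
  shows "X s \<in> space M \<rightarrow> {1..K} \<Longrightarrow> X s \<in> obs_filtration M K X Y t \<rightarrow>\<^sub>M count_space {1..K}"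
    and "Y s \<in> obs_filtration M K X Y t \<rightarrow>\<^sub>M borel"
proof -
  let ?G = "\<Union>s\<in>{1..t}. sets (vimage_algebra (space M) (X s) (count_space {1..K}))
                  \<union> sets (vimage_algebra (space M) (Y s) borel)"
  have G: "?G \<subseteq> Pow (space M)"
    using sets.space_closed[of "vimage_algebra (space M) (X s) (count_space {1..K})" for s]
      sets.space_closed[of "vimage_algebra (space M) (Y s) borel" for s]
    unfolding space_vimage_algebra by blast
  then have st: "?G \<subseteq> sets (obs_filtration M K X Y t)"
    unfolding obs_filtration_def by (auto simp: sets_measure_of)
  have *: "f \<in> obs_filtration M K X Y t \<rightarrow>\<^sub>M N"
    if "f \<in> space M \<rightarrow> space N" "sets (vimage_algebra (space M) f N) \<subseteq> ?G" for f and N :: "'z measure"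
  proof (rule measurableI)
    fix C assume "C \<in> sets N"
    then have "f -` C \<inter> space M \<in> ?G"
      using that(2) in_vimage_algebra by blast
    then show "f -` C \<inter> space (obs_filtration M K X Y t) \<in> sets (obs_filtration M K X Y t)"
      using st by auto
  qed (use that(1) in auto)
  show "X s \<in> space M \<rightarrow> {1..K} \<Longrightarrow> X s \<in> obs_filtration M K X Y t \<rightarrow>\<^sub>M count_space {1..K}"
    by (rule *) (use assms in auto)
  show "Y s \<in> obs_filtration M K X Y t \<rightarrow>\<^sub>M borel"
    by (rule *) (use assms in auto)
qed

lemma predictable_assignment:
  assumes "assignment_rule M K X Y" and "t \<ge> 1"
  shows "X t \<in> obs_filtration M K X Y (t - 1) \<rightarrow>\<^sub>M count_space {1..K}"
  using \<open>t \<ge> 1\<close>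
proof (induction t rule: less_induct)
  case (less t)
  let ?F = "obs_filtration M K X Y (t - 1)"
  show ?case
  proof (cases "t = 1")
    case True
    obtain x where x: "x \<in> {1..K}" "\<And>\<omega>. \<omega> \<in> space M \<Longrightarrow> X 1 \<omega> = x"
      using assms(1) by (auto simp: assignment_rule_def)
    have "X t \<in> ?F \<rightarrow>\<^sub>M count_space {1..K} \<longleftrightarrow> (\<lambda>_. x) \<in> ?F \<rightarrow>\<^sub>M count_space {1..K}"
      by (rule measurable_cong) (use x True in auto)
    then show ?thesis using x by auto
  next
    case False
    with less.prems have "t \<ge> 2" by auto
    then obtain h where h: "h \<in> (\<Pi>\<^sub>M s\<in>{1..<t}. count_space {1..K}) \<Otimes>\<^sub>M (\<Pi>\<^sub>M s\<in>{1..<t}. borel)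
                       \<rightarrow>\<^sub>M count_space {1..K}"
      and Xh: "\<And>\<omega>. \<omega> \<in> space M \<Longrightarrow> X t \<omega> = h (\<lambda>s\<in>{1..<t}. X s \<omega>, \<lambda>s\<in>{1..<t}. Y s \<omega>)"
      using assms(1) unfolding assignment_rule_def by blast
    have XF: "X s \<in> ?F \<rightarrow>\<^sub>M count_space {1..K}" if "s \<in> {1..<t}" for s
    proof (rule measurable_obs_filtration(1))
      show "s \<in> {1..t - 1}" using that by auto
      show "X s \<in> space M \<rightarrow> {1..K}"
        using measurable_space[OF less.IH[of s]] that by auto
    qed
    have YF: "Y s \<in> ?F \<rightarrow>\<^sub>M borel" if "s \<in> {1..<t}" for s
      by (rule measurable_obs_filtration(2)) (use that in auto)
    have "(\<lambda>\<omega>. h (\<lambda>s\<in>{1..<t}. X s \<omega>, \<lambda>s\<in>{1..<t}. Y s \<omega>)) \<in> ?F \<rightarrow>\<^sub>M count_space {1..K}"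
      by (rule measurable_compose[OF _ h]) (intro measurable_Pair measurable_restrict XF YF)
    moreover have "X t \<in> ?F \<rightarrow>\<^sub>M count_space {1..K} \<longleftrightarrow>
      (\<lambda>\<omega>. h (\<lambda>s\<in>{1..<t}. X s \<omega>, \<lambda>s\<in>{1..<t}. Y s \<omega>)) \<in> ?F \<rightarrow>\<^sub>M count_space {1..K}"
      by (rule measurable_cong) (use Xh in auto)
    ultimately show ?thesis by blast
  qed
qed

context
  fixes M :: "'a measure" and K :: nat and X :: "nat \<Rightarrow> 'a \<Rightarrow> nat"
    and Y :: "nat \<Rightarrow> 'a \<Rightarrow> 'y::topological_space"
  assumes rule: "assignment_rule M K X Y"
    and Y: "\<And>t. t \<ge> 1 \<Longrightarrow> Y t \<in> M \<rightarrow>\<^sub>M borel"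
begin

abbreviation "\<F> \<equiv> obs_filtration M K X Y"

lemma arm_in_range: "t \<ge> 1 \<Longrightarrow> \<omega> \<in> space M \<Longrightarrow> X t \<omega> \<in> {1..K}"
  using measurable_space[OF predictable_assignment[OF rule]] by fastforce

lemma measurable_arm:
  assumes "s \<in> {1..Suc t}"
  shows "X s \<in> \<F> t \<rightarrow>\<^sub>M count_space {1..K}"
proof (cases "s = Suc t")
  case True
  then show ?thesis using predictable_assignment[OF rule, of s] by simp
next
  case False
  then show ?thesis using assms arm_in_range by (intro measurable_obs_filtration(1)) auto
qed

lemma subalgebra_obs_filtration_mono: "s \<le> t \<Longrightarrow> subalgebra (\<F> t) (\<F> s)"
  unfolding subalgebra_def
  by (intro conjI sets_obs_filtration_subset measurable_arm measurable_obs_filtration(2)) auto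

lemma subalgebra_obs_filtration: "subalgebra M (\<F> t)"
proof (induction t)
  case 0
  show ?case
    unfolding subalgebra_def by (intro conjI sets_obs_filtration_subset) auto
next
  case (Suc t)
  have "X s \<in> M \<rightarrow>\<^sub>M count_space {1..K}" if "s \<in> {1..Suc t}" for s
    by (rule measurable_from_subalg[OF Suc measurable_arm[OF that]])
  then show ?case
    unfolding subalgebra_def by (intro conjI sets_obs_filtration_subset) (auto intro: Y)
qed

lemma sets_obs_filtration_Suc:
  "sets (\<F> (Suc t)) = sets (vimage_algebra (space M) (\<lambda>\<omega>. (\<omega>, Y (Suc t) \<omega>)) (\<F> t \<Otimes>\<^sub>M borel))"
    (is "_ = sets ?V")
proof
  have V: "(\<lambda>\<omega>. (\<omega>, Y (Suc t) \<omega>)) \<in> ?V \<rightarrow>\<^sub>M \<F> t \<Otimes>\<^sub>M borel"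
    by (rule measurable_vimage_algebra1) (auto simp: space_pair_measure)
  have id: "(\<lambda>\<omega>. \<omega>) \<in> ?V \<rightarrow>\<^sub>M \<F> t"
    using measurable_compose[OF V measurable_fst] by simp
  show "sets (\<F> (Suc t)) \<subseteq> sets ?V"
  proof (rule sets_obs_filtration_subset)
    show "X s \<in> ?V \<rightarrow>\<^sub>M count_space {1..K}" if "s \<in> {1..Suc t}" for s
      using measurable_compose[OF id measurable_arm[OF that]] .
    show "Y s \<in> ?V \<rightarrow>\<^sub>M borel" if "s \<in> {1..Suc t}" for s
    proof (cases "s = Suc t")
      case True
      then show ?thesis using measurable_compose[OF V measurable_snd] by simp
    next
      case False
      with that have "s \<in> {1..t}" by auto
      from measurable_compose[OF id measurable_obs_filtration(2)[OF this]] show ?thesis .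
    qed
  qed simp
  show "sets ?V \<subseteq> sets (\<F> (Suc t))"
  proof (rule sets_image_in_sets)
    have "(\<lambda>\<omega>. \<omega>) \<in> \<F> (Suc t) \<rightarrow>\<^sub>M \<F> t"
      by (rule measurable_from_subalg[OF subalgebra_obs_filtration_mono[of t "Suc t"]]) auto
    moreover have "Y (Suc t) \<in> \<F> (Suc t) \<rightarrow>\<^sub>M borel"
      by (rule measurable_obs_filtration(2)) auto
    ultimately show "(\<lambda>\<omega>. (\<omega>, Y (Suc t) \<omega>)) \<in> \<F> (Suc t) \<rightarrow>\<^sub>M \<F> t \<Otimes>\<^sub>M borel"
      by (rule measurable_Pair)
  qed simp
qed

lemma measurable_trans_prob:
  assumes "t \<ge> 1"
  shows "trans_prob \<pi> X t \<in> borel_measurable (\<F> (t - 1))"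
proof -
  have "(\<lambda>\<omega>. \<lambda>s\<in>{1..t}. X s \<omega>) \<in> \<F> (t - 1) \<rightarrow>\<^sub>M (\<Pi>\<^sub>M s\<in>{1..t}. count_space {1..K})"
    by (intro measurable_restrict measurable_arm) (use assms in auto)
  also have "(\<Pi>\<^sub>M s\<in>{1..t}. count_space {1..K}) = count_space ({1..t} \<rightarrow>\<^sub>E {1..K})"
    by (rule count_space_PiM_finite) auto
  finally have m: "(\<lambda>\<omega>. \<lambda>s\<in>{1..t}. X s \<omega>) \<in> \<F> (t - 1) \<rightarrow>\<^sub>M count_space ({1..t} \<rightarrow>\<^sub>E {1..K})" .
  show ?thesis
    unfolding trans_prob_def by (rule measurable_compose[OF m]) simp
qed

end

lemma sets_cond_algebra:
  "sets (cond_algebra M K \<Theta> X Y t I) = sigma_sets (space M)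
    (sets (obs_filtration M K X Y (t - 1))
      \<union> sets (vimage_algebra (space M) (X t) (count_space {1..K}))
      \<union> (\<Union>s\<in>I. sets (vimage_algebra (space M) (latent \<Theta> s) (count_space {0, 1}))))"
  unfolding cond_algebra_def
proof (rule sets_measure_of)
  show "(sets (obs_filtration M K X Y (t - 1))
      \<union> sets (vimage_algebra (space M) (X t) (count_space {1..K}))
      \<union> (\<Union>s\<in>I. sets (vimage_algebra (space M) (latent \<Theta> s) (count_space {0, 1}))))
    \<subseteq> Pow (space M)"
    using sets.space_closed[of "obs_filtration M K X Y (t - 1)"]
      sets.space_closed[of "vimage_algebra (space M) (X t) (count_space {1..K})"]
      sets.space_closed[of "vimage_algebra (space M) (latent \<Theta> s) (count_space {0, 1})" for s]
    unfolding space_obs_filtration space_vimage_algebra by blast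
qed

lemma space_cond_algebra [simp]: "space (cond_algebra M K \<Theta> X Y t I) = space M"
  by (simp add: cond_algebra_def space_measure_of_conv)

lemma subalgebra_cond_algebra_obs:
  "subalgebra (cond_algebra M K \<Theta> X Y t I) (obs_filtration M K X Y (t - 1))"
  unfolding subalgebra_def sets_cond_algebra by (auto intro: sigma_sets.Basic)

lemma latent_in_cond_algebra:
  assumes "s \<in> I"
  shows "{\<omega> \<in> space M. latent \<Theta> s \<omega> = i} \<in> sets (cond_algebra M K \<Theta> X Y t I)"
proof -
  let ?V = "vimage_algebra (space M) (latent \<Theta> s) (count_space {0, 1})"
  have "latent \<Theta> s -` ({i} \<inter> {0, 1}) \<inter> space M \<in> sets ?V"
    by (rule in_vimage_algebra) simp
  also have "latent \<Theta> s -` ({i} \<inter> {0, 1}) \<inter> space M = {\<omega> \<in> space M. latent \<Theta> s \<omega> = i}"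
    unfolding latent_def by force
  finally show ?thesis
    unfolding sets_cond_algebra using assms by (blast intro: sigma_sets.Basic)
qed

lemma subalgebra_cond_algebra:
  assumes "assignment_rule M K X Y" and "\<And>t. t \<ge> 1 \<Longrightarrow> Y t \<in> M \<rightarrow>\<^sub>M borel"
    and \<Theta> [measurable]: "\<Theta> \<in> M \<rightarrow>\<^sub>M count_space UNIV" and "t \<ge> 1"
  shows "subalgebra M (cond_algebra M K \<Theta> X Y t I)"
proof -
  have F: "subalgebra M (obs_filtration M K X Y (t - 1))"
    by (rule subalgebra_obs_filtration[OF assms(1,2)])
  have "latent \<Theta> s = (\<lambda>u. if enat s < u then 0 else 1) \<circ> \<Theta>" for s
    by (auto simp: latent_def)
  then have L: "latent \<Theta> s \<in> M \<rightarrow>\<^sub>M count_space {0, 1}" for s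
    using measurable_comp[OF \<Theta>] by auto
  have X: "X t \<in> M \<rightarrow>\<^sub>M count_space {1..K}"
    by (rule measurable_from_subalg[OF F predictable_assignment[OF assms(1,4)]])
  have "sets (vimage_algebra (space M) (latent \<Theta> s) (count_space {0, 1})) \<subseteq> sets M" for s
    by (rule sets_image_in_sets[OF refl L])
  moreover have "sets (vimage_algebra (space M) (X t) (count_space {1..K})) \<subseteq> sets M"
    by (rule sets_image_in_sets[OF refl X])
  moreover have "sets (obs_filtration M K X Y (t - 1)) \<subseteq> sets M"
    using F by (simp add: subalgebra_def)
  ultimately show ?thesis
    unfolding subalgebra_def sets_cond_algebra
    by (intro conjI space_cond_algebra sets.sigma_sets_subset Un_least UN_least) auto
qed

lemma odds_update:
  fixes p q f g :: real
  assumes "0 \<le> p" "p \<le> 1" "0 \<le> q" "q < 1" "0 \<le> f" "0 \<le> g"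
    and pos: "0 < p * (1 - q) * f + (1 - p * (1 - q)) * g" (is "0 < ?D")
  shows "ennreal ((1 - p * (1 - q)) * g / ?D) / ennreal (p * (1 - q) * f / ?D)
    = (ennreal (1 - p) / ennreal p + ennreal q) * (ennreal g / ennreal f / ennreal (1 - q))"
proof -
  have r: "1 - p * (1 - q) = 1 - p + p * q" by (simp add: algebra_simps)
  have r0: "0 \<le> 1 - p * (1 - q)" using assms by (simp add: r)
  consider "p = 0" | "p > 0" "f = 0" | "p > 0" "f > 0" using assms by fastforce
  then show ?thesis
  proof cases
    case 1
    with pos assms have "g > 0" by auto
    then have "ennreal g / ennreal f / ennreal (1 - q) > 0"
      using assms by (cases "f = 0") (auto simp: divide_ennreal ennreal_divide_eq_0_iff zero_less_iff_neq_zero)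
    with 1 \<open>g > 0\<close> show ?thesis by (simp add: ennreal_top_mult)
  next
    case 2
    with pos assms have "(1 - p * (1 - q)) * g > 0" by auto
    then have "1 - p + p * q > 0" "g > 0"
      using r0 \<open>0 \<le> g\<close> by (auto simp: r zero_less_mult_iff)
    have "ennreal (1 - p) / ennreal p + ennreal q = ennreal ((1 - p + p * q) / p)"
      using 2 assms by (simp add: divide_ennreal add_divide_distrib flip: ennreal_plus)
    then have "ennreal (1 - p) / ennreal p + ennreal q > 0"
      using 2 \<open>1 - p + p * q > 0\<close> by simp
    with 2 pos \<open>g > 0\<close> assms show ?thesis
      by (auto simp: ennreal_mult_top ennreal_divide_eq_0_iff ennreal_top_divide)
  next
    case 3
    have "p * (1 - q) * f > 0" using 3 assms by simp
    have 1: "ennreal (1 - p) / ennreal p + ennreal q = ennreal ((1 - p + p * q) / p)"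
      using 3 assms by (simp add: divide_ennreal add_divide_distrib flip: ennreal_plus)
    have 2: "ennreal g / ennreal f / ennreal (1 - q) = ennreal (g / f / (1 - q))"
      using 3 assms by (simp add: divide_ennreal)
    have "ennreal ((1 - p * (1 - q)) * g / ?D) / ennreal (p * (1 - q) * f / ?D)
        = ennreal ((1 - p * (1 - q)) * g / ?D / (p * (1 - q) * f / ?D))"
      using 3 pos assms r0 by (intro divide_ennreal) auto
    also have "(1 - p * (1 - q)) * g / ?D / (p * (1 - q) * f / ?D) = (1 - p * (1 - q)) * g / (p * (1 - q) * f)"
      using pos by simp
    also have "\<dots> = (1 - p + p * q) / p * (g / f / (1 - q))"
      by (simp add: r)
    also have "ennreal \<dots> = ennreal ((1 - p + p * q) / p) * ennreal (g / f / (1 - q))"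
      using 3 assms by (intro ennreal_mult) auto
    finally show ?thesis unfolding 1 2 .
  qed
qed

lemma emeasure_response:
  fixes \<mu> :: "'y::topological_space measure" and X :: "'a \<Rightarrow> nat" and Y :: "'a \<Rightarrow> 'y"
  assumes "finite_measure M" and FG: "subalgebra G F" and GM: "subalgebra M G"
    and \<mu>: "sets \<mu> = sets borel" and d: "density_family \<mu> K d"
    and X: "X \<in> F \<rightarrow>\<^sub>M count_space {1..K}" and Y: "Y \<in> M \<rightarrow>\<^sub>M borel"
    and E: "E \<in> sets G" and A: "A \<in> sets F" and B: "B \<in> sets borel"
    and law: "AE \<omega> in M. \<omega> \<in> E \<longrightarrow> real_cond_exp M G (indicator {\<omega> \<in> space M. Y \<omega> \<in> B}) \<omega>
      = measure (density \<mu> (d (X \<omega>))) B"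
    and r: "r \<in> borel_measurable F" "\<And>\<omega>. 0 \<le> r \<omega>" "\<And>\<omega>. r \<omega> \<le> 1"
    and E_r: "AE \<omega> in M. real_cond_exp M F (indicator E) \<omega> = r \<omega>"
  shows "emeasure M {\<omega> \<in> A. Y \<omega> \<in> B \<and> \<omega> \<in> E}
    = (\<integral>\<^sup>+\<omega>\<in>A. (\<integral>\<^sup>+y\<in>B. ennreal (r \<omega> * max 0 (d (X \<omega>) y)) \<partial>\<mu>) \<partial>M)"
proof -
  interpret M: finite_measure M by fact
  have FM: "subalgebra M F" using FG GM by (auto simp: subalgebra_def)
  note [measurable] = Y
  let ?S = "{\<omega> \<in> space M. Y \<omega> \<in> B}"
  define k where "k = (\<lambda>x. measure (density \<mu> (d x)) B)"
  have [measurable]: "B \<in> sets borel" "B \<in> sets \<mu>" using B \<mu> by auto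
  have d_meas [measurable]: "d x \<in> borel_measurable \<mu>" if "x \<in> {1..K}" for x
    using d that by (simp add: density_family_def)
  have prob: "prob_space (density \<mu> (d x))" if "x \<in> {1..K}" for x
  proof (rule prob_spaceI)
    have "emeasure (density \<mu> (d x)) (space \<mu>) = (\<integral>\<^sup>+y. ennreal (d x y) * indicator (space \<mu>) y \<partial>\<mu>)"
      by (rule emeasure_density) (use that in auto)
    also have "\<dots> = (\<integral>\<^sup>+y. ennreal (d x y) \<partial>\<mu>)" by (rule nn_integral_cong) simp
    also have "\<dots> = 1" using d that by (simp add: density_family_def)
    finally show "emeasure (density \<mu> (d x)) (space (density \<mu> (d x))) = 1" by simp
  qed
  have k01: "0 \<le> k x" "x \<in> {1..K} \<Longrightarrow> k x \<le> 1" for x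
    using prob_space.prob_le_1[OF prob] by (auto simp: k_def)
  have X_range: "X \<omega> \<in> {1..K}" if "\<omega> \<in> space M" for \<omega>
  proof -
    have "\<omega> \<in> space F" using that FM by (simp add: subalgebra_def)
    from measurable_space[OF X this] show ?thesis by simp
  qed
  note k_le = k01(2)[OF X_range]
  have k_meas: "(\<lambda>\<omega>. k (X \<omega>)) \<in> borel_measurable F"
    by (rule measurable_compose[OF X]) simp
  have [measurable]: "(\<lambda>\<omega>. k (X \<omega>)) \<in> borel_measurable M" "r \<in> borel_measurable M"
    using measurable_from_subalg[OF FM] k_meas r(1) by auto
  have [measurable]: "A \<in> sets M" "E \<in> sets M"
    using A E FM GM by (auto simp: subalgebra_def)
  have inner: "(\<integral>\<^sup>+y\<in>B. ennreal (r \<omega> * max 0 (d (X \<omega>) y)) \<partial>\<mu>) = ennreal (k (X \<omega>) * r \<omega>)"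
    if "\<omega> \<in> space M" for \<omega>
  proof -
    interpret P: prob_space "density \<mu> (d (X \<omega>))" by (rule prob[OF X_range[OF that]])
    have [measurable]: "d (X \<omega>) \<in> borel_measurable \<mu>" by (rule d_meas[OF X_range[OF that]])
    have "(\<integral>\<^sup>+y\<in>B. ennreal (r \<omega> * max 0 (d (X \<omega>) y)) \<partial>\<mu>)
        = (\<integral>\<^sup>+y. ennreal (r \<omega>) * (ennreal (d (X \<omega>) y) * indicator B y) \<partial>\<mu>)"
      by (rule nn_integral_cong) (simp add: ennreal_mult'' r mult.assoc max_def ennreal_neg)
    also have "\<dots> = ennreal (r \<omega>) * (\<integral>\<^sup>+y. ennreal (d (X \<omega>) y) * indicator B y \<partial>\<mu>)"
      by (rule nn_integral_cmult) measurable
    also have "(\<integral>\<^sup>+y. ennreal (d (X \<omega>) y) * indicator B y \<partial>\<mu>) = emeasure (density \<mu> (d (X \<omega>))) B"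
      by (rule emeasure_density[symmetric]) auto
    also have "\<dots> = ennreal (k (X \<omega>))"
      by (simp add: k_def P.emeasure_eq_measure)
    finally show ?thesis
      using k01(1) r by (simp add: ennreal_mult mult.commute)
  qed
  have "{\<omega> \<in> A. Y \<omega> \<in> B \<and> \<omega> \<in> E} = A \<inter> ?S \<inter> E"
    using sets.sets_into_space[OF \<open>A \<in> sets M\<close>] by auto
  then have "emeasure M {\<omega> \<in> A. Y \<omega> \<in> B \<and> \<omega> \<in> E} = ennreal (measure M (A \<inter> ?S \<inter> E))"
    by (simp add: M.emeasure_eq_measure)
  also have "measure M (A \<inter> ?S \<inter> E) = (\<integral>\<omega>\<in>A. k (X \<omega>) * real_cond_exp M F (indicator E) \<omega> \<partial>M)"
  proof (rule measure_Int_cond_exp[OF assms(1) FG GM _ E A k_meas])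
    show "\<bar>k (X \<omega>)\<bar> \<le> 1" if "\<omega> \<in> space M" for \<omega>
      using k01 X_range[OF that] by simp
  qed (use law in \<open>auto simp: k_def\<close>)
  also have "\<dots> = (\<integral>\<omega>. indicator A \<omega> * (k (X \<omega>) * r \<omega>) \<partial>M)"
    unfolding set_lebesgue_integral_def
    by (rule integral_cong_AE) (use E_r in \<open>auto elim!: eventually_mono\<close>)
  also have "ennreal \<dots> = (\<integral>\<^sup>+\<omega>. ennreal (indicator A \<omega> * (k (X \<omega>) * r \<omega>)) \<partial>M)"
  proof (rule nn_integral_eq_integral[symmetric])
    show "integrable M (\<lambda>\<omega>. indicator A \<omega> * (k (X \<omega>) * r \<omega>))"
      by (rule M.integrable_const_bound[where B=1])
         (auto simp: indicator_def abs_mult r k01(1) k_le intro!: AE_I2 mult_le_one)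
  qed (auto simp: k01 r)
  also have "\<dots> = (\<integral>\<^sup>+\<omega>\<in>A. (\<integral>\<^sup>+y\<in>B. ennreal (r \<omega> * max 0 (d (X \<omega>) y)) \<partial>\<mu>) \<partial>M)"
    by (rule nn_integral_cong) (simp add: inner split: split_indicator)
  finally show ?thesis .
qed

lemma no_change_cond_prob:
  assumes "finite_measure M" and rule: "assignment_rule M K X Y"
    and Y: "\<And>t. t \<ge> 1 \<Longrightarrow> Y t \<in> M \<rightarrow>\<^sub>M borel"
    and \<Theta>: "\<Theta> \<in> M \<rightarrow>\<^sub>M count_space UNIV" and t: "t \<ge> 1"
    and q: "\<And>\<omega>. \<omega> \<in> space M \<Longrightarrow> \<bar>trans_prob \<pi> X t \<omega>\<bar> \<le> 1"
    and cp: "change_point_model M K \<pi>0 \<pi> \<Theta> X Y"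
  shows "AE \<omega> in M. cond_probability M (obs_filtration M K X Y (t - 1)) (\<lambda>\<omega>. latent \<Theta> t \<omega> = 0) \<omega>
    = cond_probability M (obs_filtration M K X Y (t - 1)) (\<lambda>\<omega>. latent \<Theta> (t - 1) \<omega> = 0) \<omega>
      * (1 - trans_prob \<pi> X t \<omega>)"
proof -
  interpret M: finite_measure M by fact
  let ?F = "obs_filtration M K X Y (t - 1)" and ?G = "cond_algebra M K \<Theta> X Y t {t - 1}"
  let ?E = "\<lambda>t i. {\<omega> \<in> space M. latent \<Theta> t \<omega> = i}" and ?q = "trans_prob \<pi> X t"
  have FM: "subalgebra M ?F" by (rule subalgebra_obs_filtration[OF rule Y])
  have FG: "subalgebra ?G ?F" by (rule subalgebra_cond_algebra_obs)
  have GM: "subalgebra M ?G" by (rule subalgebra_cond_algebra[OF rule Y \<Theta> t])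
  interpret F: finite_measure_subalgebra M ?F by unfold_locales (rule FM)
  have E [measurable]: "?E s i \<in> sets M" for s i
    using latent_in_cond_algebra[of s "{s}" M \<Theta> i K X Y t] subalgebra_cond_algebra[OF rule Y \<Theta> t, of "{s}"]
    by (auto simp: subalgebra_def)
  have q_meas [measurable]: "?q \<in> borel_measurable ?F"
    by (rule measurable_trans_prob[OF rule Y t])
  have [measurable]: "?q \<in> borel_measurable M"
    by (rule measurable_from_subalg[OF FM q_meas])
  have int: "integrable M (indicator C :: _ \<Rightarrow> real)" if "C \<in> sets M" for C
    using that by (intro integrable_real_indicator) (auto simp: M.emeasure_eq_measure)
  let ?p = "real_cond_exp M ?F (indicator (?E (t - 1) 0))"
  have int_p: "integrable M ?p"
    by (rule F.real_cond_exp_int(1)) (rule int[OF E])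
  have int_qp: "integrable M (\<lambda>\<omega>. ?q \<omega> * ?p \<omega>)"
  proof (rule F.real_cond_exp_intg(1))
    show "integrable M (\<lambda>\<omega>. ?q \<omega> * indicator (?E (t - 1) 0) \<omega>)"
      by (rule M.integrable_const_bound[where B=1]) (auto simp: indicator_def q)
  qed (rule q_meas borel_measurable_indicator E)+
  have g_meas: "(\<lambda>\<omega>. ?p \<omega> - ?q \<omega> * ?p \<omega>) \<in> borel_measurable ?F"
    by measurable
  have "AE \<omega> in M. real_cond_exp M ?F (indicator (?E t 0)) \<omega> = ?p \<omega> - ?q \<omega> * ?p \<omega>"
  proof (rule F.real_cond_exp_charact)
    fix A assume A: "A \<in> sets ?F"
    then have [measurable]: "A \<in> sets M" using FM by (auto simp: subalgebra_def)
    have meas: "(\<integral>\<omega>\<in>A. indicator C \<omega> \<partial>M) = measure M (A \<inter> C)" if [measurable]: "C \<in> sets M" for C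
      unfolding set_lebesgue_integral_def
      by (simp add: indicator_inter_arith[symmetric] del: indicator_inter_arith)
    have "A \<inter> ?E t 0 = (A \<inter> ?E (t - 1) 0) - (A \<inter> ?E t 1 \<inter> ?E (t - 1) 0)"
    proof -
      have "enat (t - 1) < \<Theta> \<omega>" if "enat t < \<Theta> \<omega>" for \<omega>
        using that by (cases "\<Theta> \<omega>") auto
      then show ?thesis by (auto simp: latent_def split: if_splits)
    qed
    then have "(\<integral>\<omega>\<in>A. indicator (?E t 0) \<omega> \<partial>M)
        = measure M ((A \<inter> ?E (t - 1) 0) - (A \<inter> ?E t 1 \<inter> ?E (t - 1) 0))"
      by (simp add: meas)
    also have "\<dots> = measure M (A \<inter> ?E (t - 1) 0) - measure M (A \<inter> ?E t 1 \<inter> ?E (t - 1) 0)"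
      by (rule M.finite_measure_Diff) auto
    also have "measure M (A \<inter> ?E (t - 1) 0) = (\<integral>\<omega>\<in>A. ?p \<omega> \<partial>M)"
      unfolding meas[OF E, symmetric] by (rule F.real_cond_exp_intA[OF int[OF E] A])
    also have "measure M (A \<inter> ?E t 1 \<inter> ?E (t - 1) 0) = (\<integral>\<omega>\<in>A. ?q \<omega> * ?p \<omega> \<partial>M)"
    proof (rule measure_Int_cond_exp[OF assms(1) FG GM E _ A q_meas q])
      show "?E (t - 1) 0 \<in> sets ?G" by (rule latent_in_cond_algebra) simp
      show "AE \<omega> in M. \<omega> \<in> ?E (t - 1) 0 \<longrightarrow> real_cond_exp M ?G (indicator (?E t 1)) \<omega> = ?q \<omega>"
        using cp t unfolding change_point_model_def cond_probability_def
        by (auto elim!: eventually_mono)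
    qed
    also have "(\<integral>\<omega>\<in>A. ?p \<omega> \<partial>M) - (\<integral>\<omega>\<in>A. ?q \<omega> * ?p \<omega> \<partial>M) = (\<integral>\<omega>\<in>A. ?p \<omega> - ?q \<omega> * ?p \<omega> \<partial>M)"
      by (rule set_integral_diff(2)[symmetric]; unfold set_integrable_def)
         (rule integrable_mult_indicator[OF \<open>A \<in> sets M\<close>] int_p int_qp)+
    finally show "(\<integral>\<omega>\<in>A. indicator (?E t 0) \<omega> \<partial>M) = (\<integral>\<omega>\<in>A. ?p \<omega> - ?q \<omega> * ?p \<omega> \<partial>M)" .
  qed (rule int[OF E] Bochner_Integration.integrable_diff[OF int_p int_qp] g_meas)+
  then show ?thesis
    unfolding cond_probability_def by eventually_elim (simp add: algebra_simps)
qed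

theorem lemma2p1:
  fixes M :: "'a measure"
    and \<mu> :: "'y::polish_space measure"
    and K :: nat
    and f g :: "nat \<Rightarrow> 'y \<Rightarrow> real"
    and \<pi>0 :: real
    and \<pi> :: "nat \<Rightarrow> (nat \<Rightarrow> nat) \<Rightarrow> real"
    and \<Theta> :: "'a \<Rightarrow> enat"
    and X :: "nat \<Rightarrow> 'a \<Rightarrow> nat"
    and Y :: "nat \<Rightarrow> 'a \<Rightarrow> 'y"
  assumes "K \<ge> 2"
    and "prob_space M"
    and "sigma_finite_measure \<mu>" and "sets \<mu> = sets borel"
    and "density_family \<mu> K f" and "density_family \<mu> K g"
    and "0 \<le> \<pi>0" and "\<pi>0 < 1"
    and "\<And>t x. t \<ge> 1 \<Longrightarrow> x \<in> {1..t} \<rightarrow>\<^sub>E {1..K} \<Longrightarrow> 0 \<le> \<pi> t x \<and> \<pi> t x < 1"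
    and "\<Theta> \<in> M \<rightarrow>\<^sub>M count_space UNIV"
    and "\<And>t. t \<ge> 1 \<Longrightarrow> Y t \<in> M \<rightarrow>\<^sub>M borel"
    and "assignment_rule M K X Y"
    and "response_model M K \<mu> f g \<Theta> X Y"
    and "change_point_model M K \<pi>0 \<pi> \<Theta> X Y"
  shows "\<forall>t\<ge>1. AE \<omega> in M.
    posterior_odds M K \<Theta> X Y t \<omega> =
      (posterior_odds M K \<Theta> X Y (t - 1) \<omega> + ennreal (trans_prob \<pi> X t \<omega>)) *
      (likelihood_ratio f g X Y t \<omega> / ennreal (1 - trans_prob \<pi> X t \<omega>))"
proof (intro allI impI)
  fix t :: nat assume t: "t \<ge> 1"
  interpret prob_space M by fact
  have fin: "finite_measure M" by unfold_locales
  note Y = assms(11) and rule = assms(12) and \<Theta> = assms(10) and \<mu> = assms(4)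
  define F where "F = obs_filtration M K X Y (t - 1)"
  define F' where "F' = obs_filtration M K X Y t"
  define G where "G = cond_algebra M K \<Theta> X Y t {0..t}"
  define E where "E = (\<lambda>s i. {\<omega> \<in> space M. latent \<Theta> s \<omega> = i})"
  define q where "q = trans_prob \<pi> X t"
  define p where "p = real_cond_exp M F (indicator (E (t - 1) 0))"
  define r where "r = (\<lambda>\<omega>. max 0 (min 1 (p \<omega> * (1 - q \<omega>))))"
  have FM: "subalgebra M F" unfolding F_def by (rule subalgebra_obs_filtration[OF rule Y])
  have F'M: "subalgebra M F'" unfolding F'_def by (rule subalgebra_obs_filtration[OF rule Y])
  have FG: "subalgebra G F" unfolding F_def G_def by (rule subalgebra_cond_algebra_obs)
  have GM: "subalgebra M G" unfolding G_def by (rule subalgebra_cond_algebra[OF rule Y \<Theta> t])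
  have X_meas: "X t \<in> F \<rightarrow>\<^sub>M count_space {1..K}"
    unfolding F_def by (rule predictable_assignment[OF rule t])
  have F': "sets F' = sets (vimage_algebra (space M) (\<lambda>\<omega>. (\<omega>, Y t \<omega>)) (F \<Otimes>\<^sub>M \<mu>))"
    using sets_obs_filtration_Suc[OF rule Y, of "t - 1"] t \<mu>
    unfolding F_def F'_def by (simp add: sets_vimage_algebra cong: sets_pair_measure_cong)
  have Y_meas: "Y t \<in> M \<rightarrow>\<^sub>M \<mu>"
    using Y[OF t] by (simp cong: measurable_cong_sets add: \<mu>)
  have X_range: "X s \<omega> \<in> {1..K}" if "s \<ge> 1" "\<omega> \<in> space M" for s \<omega>
    by (rule arm_in_range[OF rule Y that])
  have q01: "0 \<le> q \<omega>" "q \<omega> < 1" if "\<omega> \<in> space M" for \<omega>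
    using assms(9)[OF t, of "\<lambda>s\<in>{1..t}. X s \<omega>"] X_range[OF _ that]
    by (auto simp: q_def trans_prob_def)
  have q_meas [measurable]: "q \<in> borel_measurable F"
    unfolding q_def F_def by (rule measurable_trans_prob[OF rule Y t])
  have E_G: "E t i \<in> sets G" for i
    unfolding E_def G_def by (rule latent_in_cond_algebra) simp
  have E_M [measurable]: "E s i \<in> sets M" for s i
    using latent_in_cond_algebra[of s "{s}" M \<Theta> i K X Y t] subalgebra_cond_algebra[OF rule Y \<Theta> t, of "{s}"]
    by (auto simp: subalgebra_def E_def)
  have E_compl: "E s (Suc 0) = space M - E s 0" for s
    by (auto simp: E_def latent_def)
  have r_meas [measurable]: "r \<in> borel_measurable F"
    unfolding r_def p_def by measurable
  have r01: "0 \<le> r \<omega>" "r \<omega> \<le> 1" for \<omega> by (auto simp: r_def)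
  note compl = real_cond_exp_indicator_nonneg_compl[OF fin FM E_M]
  have p01: "AE \<omega> in M. 0 \<le> p \<omega> \<and> p \<omega> \<le> 1"
    using compl(1)[of "t - 1" 0] compl(2)[of "t - 1" 0] compl(1)[of "t - 1" "Suc 0"]
    unfolding p_def E_compl by eventually_elim simp
  have r_eq: "AE \<omega> in M. r \<omega> = p \<omega> * (1 - q \<omega>)"
    using p01 AE_space
  proof eventually_elim
    case (elim \<omega>)
    then have "p \<omega> * (1 - q \<omega>) \<le> 1" by (intro mult_le_one) (use q01[of \<omega>] in auto)
    with elim show ?case using q01[of \<omega>] by (auto simp: r_def)
  qed
  have E0: "AE \<omega> in M. real_cond_exp M F (indicator (E t 0)) \<omega> = r \<omega>"
  proof -
    have "AE \<omega> in M. real_cond_exp M F (indicator (E t 0)) \<omega> = p \<omega> * (1 - q \<omega>)"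
      unfolding p_def q_def F_def E_def
      by (rule no_change_cond_prob[OF fin rule Y \<Theta> t _ assms(14), unfolded cond_probability_def])
         (use q01 in \<open>auto simp: q_def less_imp_le\<close>)
    with r_eq show ?thesis by eventually_elim simp
  qed
  have E1: "AE \<omega> in M. real_cond_exp M F (indicator (E t 1)) \<omega> = 1 - r \<omega>"
    using compl(2)[of t 0] E0 by eventually_elim (simp add: E_compl)
  have law: "AE \<omega> in M. real_cond_exp M G (indicator {\<omega> \<in> space M. Y t \<omega> \<in> B}) \<omega> =
      (if latent \<Theta> t \<omega> = 0 then measure (density \<mu> (f (X t \<omega>))) B
       else measure (density \<mu> (g (X t \<omega>))) B)" if "B \<in> sets borel" for B
    using assms(13) that t unfolding response_model_def cond_probability_def G_def by auto
  define a where "a = (\<lambda>z. r (fst z) * max 0 (f (X t (fst z)) (snd z)))"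
  define b where "b = (\<lambda>z. (1 - r (fst z)) * max 0 (g (X t (fst z)) (snd z)))"
  have d_meas: "(\<lambda>z. d (X t (fst z)) (snd z)) \<in> borel_measurable (F \<Otimes>\<^sub>M \<mu>)"
    if "density_family \<mu> K d" for d
  proof (rule measurable_compose_countable'[where f="\<lambda>i z. d i (snd z)" and I="{1..K}"])
    show "(\<lambda>z. d i (snd z)) \<in> borel_measurable (F \<Otimes>\<^sub>M \<mu>)" if "i \<in> {1..K}" for i
      by (rule measurable_compose[OF measurable_snd])
         (use \<open>density_family \<mu> K d\<close> that in \<open>auto simp: density_family_def\<close>)
  qed (rule measurable_compose[OF measurable_fst X_meas], simp)
  note [measurable] = d_meas[OF assms(5)] d_meas[OF assms(6)]
  have a_meas: "a \<in> borel_measurable (F \<Otimes>\<^sub>M \<mu>)" and b_meas: "b \<in> borel_measurable (F \<Otimes>\<^sub>M \<mu>)"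
    unfolding a_def b_def by measurable
  have ab0: "0 \<le> a z" "0 \<le> b z" for z by (auto simp: a_def b_def r01)
  have eq_a: "emeasure M {\<omega> \<in> A. Y t \<omega> \<in> B \<and> \<omega> \<in> E t 0} = (\<integral>\<^sup>+\<omega>\<in>A. (\<integral>\<^sup>+y\<in>B. a (\<omega>, y) \<partial>\<mu>) \<partial>M)"
    if "A \<in> sets F" "B \<in> sets \<mu>" for A B
    unfolding a_def fst_conv snd_conv
  proof (rule emeasure_response[OF fin FG GM \<mu> assms(5) X_meas Y[OF t] E_G that(1) _ _ r_meas r01 E0])
    show B: "B \<in> sets borel" using that \<mu> by simp
    show "AE \<omega> in M. \<omega> \<in> E t 0 \<longrightarrow> real_cond_exp M G (indicator {\<omega> \<in> space M. Y t \<omega> \<in> B}) \<omega>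
        = measure (density \<mu> (f (X t \<omega>))) B"
      using law[OF B] by eventually_elim (simp add: E_def)
  qed
  have eq_b: "emeasure M {\<omega> \<in> A. Y t \<omega> \<in> B \<and> \<omega> \<in> E t 1} = (\<integral>\<^sup>+\<omega>\<in>A. (\<integral>\<^sup>+y\<in>B. b (\<omega>, y) \<partial>\<mu>) \<partial>M)"
    if "A \<in> sets F" "B \<in> sets \<mu>" for A B
    unfolding b_def fst_conv snd_conv
  proof (rule emeasure_response[OF fin FG GM \<mu> assms(6) X_meas Y[OF t] E_G that(1) _ _ _ _ _ E1])
    show B: "B \<in> sets borel" using that \<mu> by simp
    show "AE \<omega> in M. \<omega> \<in> E t 1 \<longrightarrow> real_cond_exp M G (indicator {\<omega> \<in> space M. Y t \<omega> \<in> B}) \<omega>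
        = measure (density \<mu> (g (X t \<omega>))) B"
      using law[OF B] by eventually_elim (simp add: E_def)
  qed (auto simp: r01)
  have compl_E: "space M - E t 0 = E t 1" "space M - E t 1 = E t 0"
    by (auto simp: E_def latent_def)
  let ?D = "\<lambda>\<omega>. a (\<omega>, Y t \<omega>) + b (\<omega>, Y t \<omega>)"
  have D_pos: "AE \<omega> in M. 0 < ?D \<omega>"
    by (rule real_cond_exp_bayes(1)[OF fin FM F'M assms(3) F' Y_meas E_M[of t 0]
          a_meas ab0(1) b_meas ab0(2) eq_a eq_b[folded compl_E(1)]])
  have bayes0: "AE \<omega> in M. real_cond_exp M F' (indicator (E t 0)) \<omega> = a (\<omega>, Y t \<omega>) / ?D \<omega>"
    by (rule real_cond_exp_bayes(2)[OF fin FM F'M assms(3) F' Y_meas E_M[of t 0]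
          a_meas ab0(1) b_meas ab0(2) eq_a eq_b[folded compl_E(1)]])
  have bayes1: "AE \<omega> in M. real_cond_exp M F' (indicator (E t 1)) \<omega> = b (\<omega>, Y t \<omega>) / ?D \<omega>"
    unfolding add.commute[of "a _"]
    by (rule real_cond_exp_bayes(2)[OF fin FM F'M assms(3) F' Y_meas E_M[of t 1]
          b_meas ab0(2) a_meas ab0(1) eq_b eq_a[folded compl_E(2)]])
  have prev: "AE \<omega> in M. real_cond_exp M F (indicator (E (t - 1) 1)) \<omega> = 1 - p \<omega>"
    using compl(2)[of "t - 1" 0] by (simp add: E_compl p_def)
  show "AE \<omega> in M. posterior_odds M K \<Theta> X Y t \<omega> =
      (posterior_odds M K \<Theta> X Y (t - 1) \<omega> + ennreal (trans_prob \<pi> X t \<omega>)) *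
      (likelihood_ratio f g X Y t \<omega> / ennreal (1 - trans_prob \<pi> X t \<omega>))"
    using D_pos bayes0 bayes1 prev p01 r_eq AE_space
  proof eventually_elim
    case (elim \<omega>)
    let ?f = "f (X t \<omega>) (Y t \<omega>)" and ?g = "g (X t \<omega>) (Y t \<omega>)"
    have "X t \<omega> \<in> {1..K}" by (rule X_range) (use t elim in auto)
    moreover have "Y t \<omega> \<in> space \<mu>" using measurable_space[OF Y_meas] elim by auto
    ultimately have fg0: "0 \<le> ?f" "0 \<le> ?g"
      using assms(5,6) by (auto simp: density_family_def)
    have a: "a (\<omega>, Y t \<omega>) = p \<omega> * (1 - q \<omega>) * ?f"
      and b: "b (\<omega>, Y t \<omega>) = (1 - p \<omega> * (1 - q \<omega>)) * ?g"
      using fg0 elim by (simp_all add: a_def b_def)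
    have "posterior_odds M K \<Theta> X Y t \<omega> = ennreal (b (\<omega>, Y t \<omega>) / (a (\<omega>, Y t \<omega>) + b (\<omega>, Y t \<omega>)))
        / ennreal (a (\<omega>, Y t \<omega>) / (a (\<omega>, Y t \<omega>) + b (\<omega>, Y t \<omega>)))"
      using elim by (simp add: posterior_odds_def cond_probability_def F'_def E_def add.commute)
    also have "\<dots> = (ennreal (1 - p \<omega>) / ennreal (p \<omega>) + ennreal (q \<omega>))
        * (ennreal ?g / ennreal ?f / ennreal (1 - q \<omega>))"
      unfolding a b by (rule odds_update) (use elim q01[of \<omega>] fg0 a b in auto)
    also have "ennreal (1 - p \<omega>) / ennreal (p \<omega>) = posterior_odds M K \<Theta> X Y (t - 1) \<omega>"
      using elim by (simp add: posterior_odds_def cond_probability_def F_def E_def p_def)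
    finally show ?case by (simp add: likelihood_ratio_def q_def)
  qed
qed

end
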